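(* Let $(t,a,x_3,y_3,z_3,\mu)=(-5/8,\ 1,\ 15/7,\ 11/4,\ 5/2,\ 2/7)$, $c=\frac{t^2-1}{t^2+1}$, $s=\frac{2t}{t^2+1}$, and define points of $\mathbb{R}^3$ $$p_{\mathsf T}=(0,0,a),\quad p_{\mathsf B}=(0,0,-a),\quad p_3=(x_3,y_3,z_3),\quad p_1=(x_3,-y_3,-z_3),$$ $$p_5=(c\,x_3+s\,y_3,\ -c\,y_3+s\,x_3,\ -z_3),$$ $$p_2=\bigl(-(\mu(c-1)-c)x_3-(\mu s-s)y_3,\ (\mu s-s)x_3-(\mu(c-1)-c)y_3,\ z_3\bigr),$$ $$p_4=\bigl(-\mu s\,y_3+(\mu(c-1)+1)x_3,\ \mu s\,x_3+(\mu(c-1)+1)y_3,\ z_3\bigr),$$ $$p_{\mathsf N}=p_1-\tfrac{9}{10}(p_2-p_1)+3(p_{\mathsf B}-p_1)+\tfrac35 (p_2-p_1)\times(p_{\mathsf B}-p_1).$$ Then the realization of the subdivided pentagonal bipyramid $\mathbb{S}$ sending each vertex $v$ to $p_v$ has a flex with no self-intersections; hence it yields an example of a flexible embedded polyhedron with $8$ vertices.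
   Context: $\mathbb{S}$ is the abstract simplicial complex on the vertex set $V=\{1,2,3,4,5,\mathsf T,\mathsf B,\mathsf N\}$ consisting of the triangles $\{\mathsf T,1,2\},\{\mathsf T,2,3\},\{\mathsf T,3,4\},\{\mathsf T,4,5\},\{\mathsf T,5,1\}$, $\{\mathsf B,2,3\},\{\mathsf B,3,4\},\{\mathsf B,4,5\},\{\mathsf B,5,1\}$, $\{\mathsf N,\mathsf B,1\},\{\mathsf N,1,2\},\{\mathsf N,\mathsf B,2\}$ and all their subsets. For an abstract simplicial complex $\mathcal{K}$ on $V$, $|\mathcal{K}|\subset\mathbb{R}^V$ is the union of the convex hulls of $\{e_v\}_{v\in\sigma}$ for $\sigma\in\mathcal{K}$. A realization of $\mathcal{K}$ is a map $\rho:|\mathcal{K}|\to\mathbb{R}^3$ affine-linear on each simplex; it is determined by the images of the vertices. A polyhedron is a realization of a complex with $|\mathcal{K}|$ homeomorphic to a $2$-sphere; it is embedded (has no self-intersections) if $\rho$ is injective. A flex of a polyhedron $\rho$ is a continuous map $f:[0,1)\to(\mathbb{R}^3)^V$ such that $f(0)=\rho$ (on vertices), every $f(t)$ induces the same edge lengths as $\rho$ on all edges of $\mathcal{K}$ (with adjacent vertices having distinct images), and $f(t_1)$, $f(t_2)$ are not related by a direct isometry of $\mathbb{R}^3$ for $t_1\ne t_2$. A flex has no self-intersections (is a flex of an embedded polyhedron) if the polyhedron determined by $f(t)$ is embedded for all $t\in[0,1)$. *)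

theory Defs
  imports "HOL-Analysis.Analysis"
begin

section \<open>Abstract simplicial complexes and their realizations\<close>

text \<open>
  The vertex set is the whole (finite) type \<open>'v\<close>, so every vertex is required to span a face.
\<close>

definition abstract_complex :: "'v::finite set set \<Rightarrow> bool" where
  "abstract_complex K \<longleftrightarrow> (\<forall>v. {v} \<in> K) \<and> (\<forall>\<sigma>\<in>K. \<forall>\<tau>. \<tau> \<subseteq> \<sigma> \<longrightarrow> \<tau> \<in> K)"

abbreviation vertex_point :: "'v::finite \<Rightarrow> real^'v" where
  "vertex_point v \<equiv> axis v 1"

definition face :: "'v::finite set \<Rightarrow> (real^'v) set" where
  "face \<sigma> = convex hull (vertex_point ` \<sigma>)"

definition geometric_body :: "'v::finite set set \<Rightarrow> (real^'v) set" where
  "geometric_body K = (\<Union>\<sigma>\<in>K. face \<sigma>)"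

definition affine_linear_on :: "'a::real_vector set \<Rightarrow> ('a \<Rightarrow> 'b::real_vector) \<Rightarrow> bool" where
  "affine_linear_on S f \<longleftrightarrow>
     (\<forall>x\<in>S. \<forall>y\<in>S. \<forall>u\<in>{0..1}. f ((1 - u) *\<^sub>R x + u *\<^sub>R y) = (1 - u) *\<^sub>R f x + u *\<^sub>R f y)"

text \<open>Maps on the geometric body are total functions; their values outside of it are irrelevant.\<close>

definition realization :: "'v::finite set set \<Rightarrow> (real^'v \<Rightarrow> real^3) \<Rightarrow> bool" where
  "realization K \<rho> \<longleftrightarrow> (\<forall>\<sigma>\<in>K. affine_linear_on (face \<sigma>) \<rho>)"

text \<open>
  The realization determined by the images \<open>p $ v\<close> of the vertices. The three lemmas below show
  that it is a realization of every complex, that it has the prescribed values on the vertices,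
  and that it is the only such realization.
\<close>

definition realization_of :: "(real^3)^'v::finite \<Rightarrow> real^'v \<Rightarrow> real^3" where
  "realization_of p x = (\<Sum>v\<in>UNIV. x $ v *\<^sub>R p $ v)"

lemma realization_of_affine:
  "realization_of p ((1 - u) *\<^sub>R x + u *\<^sub>R y) =
     (1 - u) *\<^sub>R realization_of p x + u *\<^sub>R realization_of p y"
  by (simp add: realization_of_def scaleR_sum_right sum.distrib[symmetric] scaleR_add_left)

lemma realization_realization_of: "realization K (realization_of p)"
  by (simp add: realization_def affine_linear_on_def realization_of_affine)

lemma realization_of_vertex_point: "realization_of p (vertex_point v) = p $ v"
proof -
  have "realization_of p (vertex_point v) = (\<Sum>w\<in>UNIV. if w = v then p $ w else 0)"
    unfolding realization_of_def by (intro sum.cong) (auto simp: axis_def)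
  then show ?thesis by simp
qed

lemma realization_unique:
  assumes "realization K \<rho>" and "\<And>v. \<rho> (vertex_point v) = p $ v" and "x \<in> geometric_body K"
  shows "\<rho> x = realization_of p x"
proof -
  obtain \<sigma> where \<sigma>: "\<sigma> \<in> K" "x \<in> face \<sigma>"
    using assms(3) by (auto simp: geometric_body_def)
  let ?A = "{y \<in> face \<sigma>. \<rho> y = realization_of p y}"
  have aff: "affine_linear_on (face \<sigma>) \<rho>"
    using assms(1) \<sigma>(1) by (simp add: realization_def)
  have "convex (face \<sigma>)" by (simp add: face_def)
  then have "convex ?A"
    using aff by (simp add: convex_alt affine_linear_on_def realization_of_affine)
  moreover have "vertex_point ` \<sigma> \<subseteq> ?A"
    using assms(2) by (auto simp: realization_of_vertex_point face_def hull_inc)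
  ultimately have "face \<sigma> \<subseteq> ?A"
    unfolding face_def by (intro hull_minimal) auto
  then show ?thesis using \<sigma>(2) by auto
qed

section \<open>Polyhedra and flexes\<close>

text \<open>The name \<open>polyhedron\<close> is used in HOL-Analysis for intersections of half-spaces.\<close>

definition spherical_polyhedron :: "'v::finite set set \<Rightarrow> (real^'v \<Rightarrow> real^3) \<Rightarrow> bool" where
  "spherical_polyhedron K \<rho> \<longleftrightarrow>
     abstract_complex K \<and> realization K \<rho> \<and> geometric_body K homeomorphic sphere (0::real^3) 1"

definition embedded :: "'v::finite set set \<Rightarrow> (real^'v \<Rightarrow> real^3) \<Rightarrow> bool" where
  "embedded K \<rho> \<longleftrightarrow> inj_on \<rho> (geometric_body K)"

definition direct_isometry :: "(real^3 \<Rightarrow> real^3) \<Rightarrow> bool" where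
  "direct_isometry g \<longleftrightarrow> (\<exists>A b. rotation_matrix A \<and> g = (\<lambda>x. A *v x + b))"

definition flex ::
  "'v::finite set set \<Rightarrow> (real^'v \<Rightarrow> real^3) \<Rightarrow> (real \<Rightarrow> (real^3)^'v) \<Rightarrow> bool" where
  "flex K \<rho> f \<longleftrightarrow>
     continuous_on {0..<1} f \<and>
     (\<forall>v. f 0 $ v = \<rho> (vertex_point v)) \<and>
     (\<forall>t\<in>{0..<1}. \<forall>u v. u \<noteq> v \<and> {u, v} \<in> K \<longrightarrow>
        dist (f t $ u) (f t $ v) = dist (\<rho> (vertex_point u)) (\<rho> (vertex_point v)) \<and>
        f t $ u \<noteq> f t $ v) \<and>
     (\<forall>t\<^sub>1\<in>{0..<1}. \<forall>t\<^sub>2\<in>{0..<1}. t\<^sub>1 \<noteq> t\<^sub>2 \<longrightarrow>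
        \<not> (\<exists>g. direct_isometry g \<and> (\<forall>v. f t\<^sub>2 $ v = g (f t\<^sub>1 $ v))))"

definition no_self_intersections :: "'v::finite set set \<Rightarrow> (real \<Rightarrow> (real^3)^'v) \<Rightarrow> bool" where
  "no_self_intersections K f \<longleftrightarrow> (\<forall>t\<in>{0..<1}. embedded K (realization_of (f t)))"

definition flexible_embedded_polyhedron ::
  "'v::finite set set \<Rightarrow> (real^'v \<Rightarrow> real^3) \<Rightarrow> bool" where
  "flexible_embedded_polyhedron K \<rho> \<longleftrightarrow>
     spherical_polyhedron K \<rho> \<and> embedded K \<rho> \<and> (\<exists>f. flex K \<rho> f \<and> no_self_intersections K f)"

section \<open>The subdivided pentagonal bipyramid\<close>

datatype vertex = V1 | V2 | V3 | V4 | V5 | VT | VB | VN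

lemma UNIV_vertex: "(UNIV :: vertex set) = {V1, V2, V3, V4, V5, VT, VB, VN}"
  using vertex.exhaust by blast

instance vertex :: finite
  by standard (simp add: UNIV_vertex)

definition bipyramid_triangles :: "vertex set set" where
  "bipyramid_triangles =
     {{VT, V1, V2}, {VT, V2, V3}, {VT, V3, V4}, {VT, V4, V5}, {VT, V5, V1},
      {VB, V2, V3}, {VB, V3, V4}, {VB, V4, V5}, {VB, V5, V1},
      {VN, VB, V1}, {VN, V1, V2}, {VN, VB, V2}}"

definition subdivided_bipyramid :: "vertex set set" where
  "subdivided_bipyramid = {\<sigma>. \<exists>\<tau>\<in>bipyramid_triangles. \<sigma> \<subseteq> \<tau>}"

end

theory Submission
  imports Defs
begin

text \<open>
  Up to isometry the pentagonal bipyramids of the family considered here depend on the five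
  parameters \<open>a, x, y, z\<close> and the rotation \<open>(c, s)\<close>, while their edge lengths are functions of only four
  quantities. Hence they flex, with the length \<open>2 a\<close> of the non-edge \<open>VT VB\<close> as parameter; the vertex
  \<open>VN\<close> follows rigidly the triangle \<open>VB V1 V2\<close>. The initial polyhedron is embedded because any two of
  its facets are separated by a plane meeting them only in their common face, and embeddedness is an open
  condition, so the flex stays embedded for a short time. The body of the complex is a sphere
  because radial projection identifies it with a complete simplicial fan.
\<close>

text \<open>With seven vertices and fifteen edges a generic pentagonal bipyramid is rigid; the
  symmetry of the family supplies the missing freedom. The half-turn about the first axis swaps
  \<open>VT\<close> and \<open>VB\<close> and takes \<open>V3\<close> to \<open>V1\<close>; the
  rotation about the third axis fixes both apexes and takes \<open>V1\<close> to \<open>V5\<close>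
  and \<open>V2\<close> to \<open>V4\<close>. Many edge lengths therefore coincide, and because
  \<open>V2\<close> and \<open>V4\<close> divide chords between \<open>V3\<close> and its rotated
  copies in a fixed ratio, all squared lengths are linear combinations of a few quantities.

  The vertex \<open>VN\<close> serves embeddedness only: in the initial position the edge
  \<open>V4\<close> \<open>V5\<close> pierces the triangle \<open>VB\<close> \<open>V1\<close>
  \<open>V2\<close>, so the plain bipyramid intersects itself. The tent over this triangle with apex
  \<open>VN\<close>, which lies on the side of \<open>V5\<close> and farther than \<open>V5\<close>
  from the plane of the triangle, goes around that edge.\<close>

lemma convex_coordinate_face:
  "convex {x::real^'v::finite. (\<forall>v. 0 \<le> x $ v) \<and> (\<forall>v. v \<notin> \<sigma> \<longrightarrow> x $ v = 0) \<and> (\<Sum>v\<in>UNIV. x $ v) = 1}"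
  unfolding convex_def by (auto simp: sum.distrib simp flip: sum_distrib_left)

text \<open>The vertices are standard basis vectors, so the coordinates of a point are its
  barycentric coordinates. Later arguments can thus work with supports and signs instead of convex
  hulls.\<close>

lemma face_eq:
  "face \<sigma> = {x::real^'v::finite. (\<forall>v. 0 \<le> x $ v) \<and> (\<forall>v. v \<notin> \<sigma> \<longrightarrow> x $ v = 0) \<and> (\<Sum>v\<in>UNIV. x $ v) = 1}"
  (is "_ = ?F")
proof (rule antisym)
  show "face \<sigma> \<subseteq> ?F"
    unfolding face_def by (rule hull_minimal) (auto simp: convex_coordinate_face axis_def)
  show "?F \<subseteq> face \<sigma>"
  proof
    fix x assume x: "x \<in> ?F"
    have supp: "(\<Sum>v\<in>UNIV. x $ v) = (\<Sum>v\<in>\<sigma>. x $ v)"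
      using x by (intro sum.mono_neutral_right) auto
    have "x = (\<Sum>v\<in>UNIV. x $ v *\<^sub>R vertex_point v)"
      by (simp add: vec_eq_iff axis_def if_distrib [of "\<lambda>t. _ * t"] cong: if_cong)
    also have "\<dots> = (\<Sum>v\<in>\<sigma>. x $ v *\<^sub>R vertex_point v)"
      using x by (intro sum.mono_neutral_right) auto
    also have "\<dots> \<in> convex hull (vertex_point ` \<sigma>)"
      using x supp by (intro convex_sum) (auto simp: hull_inc)
    finally show "x \<in> face \<sigma>" by (simp add: face_def)
  qed
qed

lemma mem_geometric_body_iff:
  fixes K :: "'v::finite set set"
  assumes "abstract_complex K"
  shows "x \<in> geometric_body K \<longleftrightarrow>
    (\<forall>v. 0 \<le> x $ v) \<and> {v. x $ v \<noteq> 0} \<in> K \<and> (\<Sum>v\<in>UNIV. x $ v) = 1"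
proof
  assume "x \<in> geometric_body K"
  then obtain \<sigma> where "\<sigma> \<in> K" "x \<in> face \<sigma>" by (auto simp: geometric_body_def)
  moreover from this have "{v. x $ v \<noteq> 0} \<subseteq> \<sigma>" by (auto simp: face_eq)
  ultimately show "(\<forall>v. 0 \<le> x $ v) \<and> {v. x $ v \<noteq> 0} \<in> K \<and> (\<Sum>v\<in>UNIV. x $ v) = 1"
    using assms by (auto simp: abstract_complex_def face_eq)
next
  assume "(\<forall>v. 0 \<le> x $ v) \<and> {v. x $ v \<noteq> 0} \<in> K \<and> (\<Sum>v\<in>UNIV. x $ v) = 1"
  then show "x \<in> geometric_body K"
    by (auto simp: geometric_body_def face_eq intro!: bexI [of _ "{v. x $ v \<noteq> 0}"])
qed

lemma realization_of_diff: "realization_of p (x - y) = realization_of p x - realization_of p y"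
  by (simp add: realization_of_def scaleR_diff_left sum_subtractf)

lemma realization_of_scaleR: "realization_of p (u *\<^sub>R x) = u *\<^sub>R realization_of p x"
  by (simp add: realization_of_def scaleR_sum_right)

lemma realization_of_nth: "realization_of p x $ i = (\<Sum>v\<in>UNIV. x $ v * p $ v $ i)"
  by (simp add: realization_of_def)

lemma continuous_on_realization_of [continuous_intros]:
  assumes "continuous_on S f" "continuous_on S g"
  shows "continuous_on S (\<lambda>x. realization_of (f x) (g x))"
  unfolding realization_of_def by (intro continuous_intros assms)

section \<open>Embeddedness is an open condition\<close>

text \<open>
  Two points of the body with the same image differ by such a vector; conversely the positive
  and the negative part of such a vector, normalised, are two points of the body.
\<close>

definition sign_dependence :: "'v::finite set set \<Rightarrow> real^'v \<Rightarrow> bool" where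
  "sign_dependence K d \<longleftrightarrow>
     (\<Sum>v\<in>UNIV. d $ v) = 0 \<and> {v. 0 < d $ v} \<in> K \<and> {v. d $ v < 0} \<in> K"

text \<open>In this form failure of injectivity is a homogeneous condition on one vector, so it may
  be tested on the unit sphere.\<close>

lemma embedded_iff:
  fixes K :: "'v::finite set set"
  assumes K: "abstract_complex K"
  shows "embedded K (realization_of p) \<longleftrightarrow>
    (\<forall>d. sign_dependence K d \<and> realization_of p d = 0 \<longrightarrow> d = 0)"
proof (intro iffI allI impI)
  assume R: "\<forall>d. sign_dependence K d \<and> realization_of p d = 0 \<longrightarrow> d = 0"
  show "embedded K (realization_of p)"
    unfolding embedded_def
  proof (rule inj_onI)
    fix x y assume xy: "x \<in> geometric_body K" "y \<in> geometric_body K"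
      and eq: "realization_of p x = realization_of p y"
    have nonneg: "0 \<le> x $ v" "0 \<le> y $ v" for v
      using xy by (auto simp: mem_geometric_body_iff [OF K])
    have "{v. 0 < (x - y) $ v} \<subseteq> {v. x $ v \<noteq> 0}" "{v. (x - y) $ v < 0} \<subseteq> {v. y $ v \<noteq> 0}"
      using nonneg by (auto simp: not_less) (metis nonneg order.antisym not_less)+
    then have "sign_dependence K (x - y)"
      using xy K unfolding sign_dependence_def mem_geometric_body_iff [OF K] abstract_complex_def
      by (auto simp: sum_subtractf)
    with R eq show "x = y" by (auto simp: realization_of_diff)
  qed
next
  fix d
  assume inj: "embedded K (realization_of p)"
    and d: "sign_dependence K d \<and> realization_of p d = 0"
  show "d = 0"
  proof (rule ccontr)
    assume "d \<noteq> 0"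
    define x y :: "real^'v" where "x = (\<chi> v. max 0 (d $ v))" and "y = (\<chi> v. max 0 (- d $ v))"
    have xy: "x - y = d" by (auto simp: x_def y_def vec_eq_iff)
    define P where "P = (\<Sum>v\<in>UNIV. x $ v)"
    have "P - (\<Sum>v\<in>UNIV. y $ v) = (\<Sum>v\<in>UNIV. (x - y) $ v)"
      by (simp add: P_def sum_subtractf)
    then have Py: "(\<Sum>v\<in>UNIV. y $ v) = P"
      using d xy by (simp add: sign_dependence_def)
    have "P \<noteq> 0"
    proof
      assume "P = 0"
      then have "x $ v = 0 \<and> y $ v = 0" for v
        using Py unfolding P_def by (simp add: x_def y_def sum_nonneg_eq_0_iff)
      then have "x = 0" "y = 0" by (auto simp: vec_eq_iff)
      with xy \<open>d \<noteq> 0\<close> show False by simp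
    qed
    then have P: "P > 0"
      by (simp add: P_def x_def sum_nonneg order_less_le)
    have supp: "{v. ((1 / P) *\<^sub>R x) $ v \<noteq> 0} = {v. 0 < d $ v}"
      "{v. ((1 / P) *\<^sub>R y) $ v \<noteq> 0} = {v. d $ v < 0}"
      using P by (auto simp: x_def y_def max_def)
    have "(1 / P) *\<^sub>R x \<in> geometric_body K" "(1 / P) *\<^sub>R y \<in> geometric_body K"
      unfolding mem_geometric_body_iff [OF K] supp
      using d P Py by (auto simp: sign_dependence_def x_def y_def P_def simp flip: sum_divide_distrib)
    moreover have "realization_of p ((1 / P) *\<^sub>R x) = realization_of p ((1 / P) *\<^sub>R y)"
      using d unfolding realization_of_scaleR xy [symmetric] realization_of_diff by simp
    ultimately have "(1 / P) *\<^sub>R x = (1 / P) *\<^sub>R y"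
      using inj by (simp only: embedded_def inj_on_def)
    then have "x = y" using P by simp
    then show False using xy \<open>d \<noteq> 0\<close> by simp
  qed
qed

text \<open>The sign dependences of norm one form a compact set that does not depend on
  \<open>p\<close>. The non-embedded \<open>p\<close> are the projection of a closed set along this
  compact factor, hence a closed set.\<close>

lemma open_embedded:
  fixes K :: "'v::finite set set"
  assumes K: "abstract_complex K"
  shows "open {p. embedded K (realization_of p)}"
proof -
  let ?D = "{d::real^'v. sign_dependence K d} \<inter> sphere 0 1"
  \<comment> \<open>Strict signs hide closedness. As \<open>K\<close> is closed under subsets, it is
    enough to bound the two supports by faces, which leaves a finite union of sets given by weak
    inequalities.\<close>
  have "{d::real^'v. sign_dependence K d} =
    {d. (\<Sum>v\<in>UNIV. d $ v) = 0} \<inter>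
    (\<Union>\<sigma>\<in>K. \<Union>\<tau>\<in>K. (\<Inter>v\<in>-\<sigma>. {d. d $ v \<le> 0}) \<inter> (\<Inter>v\<in>-\<tau>. {d. 0 \<le> d $ v}))"
    (is "?L = ?S \<inter> ?R")
  proof (intro equalityI subsetI)
    fix d :: "real^'v" assume "d \<in> ?L"
    then have d: "(\<Sum>v\<in>UNIV. d $ v) = 0" "{v. 0 < d $ v} \<in> K" "{v. d $ v < 0} \<in> K"
      by (auto simp: sign_dependence_def)
    have "d \<in> (\<Inter>v\<in>-{v. 0 < d $ v}. {d. d $ v \<le> 0}) \<inter> (\<Inter>v\<in>-{v. d $ v < 0}. {d. 0 \<le> d $ v})"
      by (auto simp: not_less)
    with d show "d \<in> ?S \<inter> ?R" by blast
  next
    fix d assume d: "d \<in> ?S \<inter> ?R"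
    then obtain \<sigma> \<tau> where "\<sigma> \<in> K" "\<tau> \<in> K" "\<forall>v\<in>-\<sigma>. d $ v \<le> 0" "\<forall>v\<in>-\<tau>. 0 \<le> d $ v"
      by auto
    moreover from this have "{v. 0 < d $ v} \<subseteq> \<sigma>" "{v. d $ v < 0} \<subseteq> \<tau>"
      by force+
    ultimately show "d \<in> ?L"
      using d K by (auto simp: sign_dependence_def abstract_complex_def)
  qed
  moreover have "closed \<dots>"
    by (intro closed_Int closed_UN closed_INT ballI closed_Collect_eq closed_Collect_le
        continuous_intros finite) 
  ultimately have "closed {d::real^'v. sign_dependence K d}" by (simp only:)
  then have D: "compact ?D"
    by (rule closed_Int_compact) simp
  have "closed {p. \<exists>d. d \<in> ?D \<and> (d, p) \<in> {dp :: (real^'v) \<times> ((real^3)^'v). realization_of (snd dp) (fst dp) = 0}}"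
    by (intro closed_compact_projection [OF D] closed_Collect_eq continuous_intros)
  moreover have "- {p. embedded K (realization_of p)} =
    {p. \<exists>d. d \<in> ?D \<and> (d, p) \<in> {dp :: (real^'v) \<times> ((real^3)^'v). realization_of (snd dp) (fst dp) = 0}}"
    (is "_ = ?Z")
  proof (intro equalityI subsetI)
    fix p assume "p \<in> - {p. embedded K (realization_of p)}"
    then obtain d where d: "sign_dependence K d" "realization_of p d = 0" "d \<noteq> 0"
      by (auto simp: embedded_iff [OF K])
    then have "sign_dependence K ((1 / norm d) *\<^sub>R d)"
      by (simp add: sign_dependence_def zero_less_divide_iff divide_less_0_iff
          flip: sum_divide_distrib)
    then show "p \<in> ?Z"
      using d by (auto simp: realization_of_scaleR intro!: exI [of _ "(1 / norm d) *\<^sub>R d"])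
  qed (auto simp: embedded_iff [OF K])
  ultimately show ?thesis by (simp only: open_closed)
qed

section \<open>Recognising the sphere\<close>

text \<open>
  The inverse \<open>G\<close> certifies that the cones over the images of the faces form a complete
  simplicial fan; the homeomorphism is then the radial projection.
\<close>

lemma geometric_body_homeomorphic_sphere:
  fixes K :: "'v::finite set set" and q :: "(real^3)^'v" and G :: "real^3 \<Rightarrow> real^'v"
  assumes K: "abstract_complex K"
    and left: "\<And>x. \<lbrakk>\<forall>v. 0 \<le> x $ v; {v. x $ v \<noteq> 0} \<in> K\<rbrakk> \<Longrightarrow> G (realization_of q x) = x"
    and right: "\<And>w. realization_of q (G w) = w"
    and nonneg: "\<And>w v. 0 \<le> G w $ v"
    and supp: "\<And>w. {v. G w $ v \<noteq> 0} \<in> K"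
  shows "geometric_body K homeomorphic sphere (0::real^3) 1"
proof -
  let ?L = "realization_of q"
  have inj: "x = y" if "\<forall>v. 0 \<le> x $ v" "{v. x $ v \<noteq> 0} \<in> K" "\<forall>v. 0 \<le> y $ v"
    "{v. y $ v \<noteq> 0} \<in> K" "?L x = ?L y" for x y
    using left that by metis
  have empty: "{} \<in> K"
    using K by (auto simp: abstract_complex_def)
  have nz: "?L x \<noteq> 0" if "x \<in> geometric_body K" for x
  proof
    assume "?L x = 0"
    then have "x = 0"
      using that empty by (intro inj) (auto simp: mem_geometric_body_iff [OF K] realization_of_def)
    then show False using that by (auto simp: mem_geometric_body_iff [OF K])
  qed
  let ?h = "\<lambda>x. (1 / norm (?L x)) *\<^sub>R ?L x"
  have compact: "compact (geometric_body K)"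
    unfolding geometric_body_def face_def
    by (intro compact_UN finite compact_convex_hull finite_imp_compact) auto
  have cont: "continuous_on (geometric_body K) ?h"
    using nz by (intro continuous_intros) auto
  have img: "?h ` geometric_body K = sphere 0 1"
  proof (intro equalityI subsetI)
    fix w assume "w \<in> ?h ` geometric_body K"
    then show "w \<in> sphere 0 1" using nz by auto
  next
    fix w :: "real^3" assume w: "w \<in> sphere 0 1"
    define P where "P = (\<Sum>v\<in>UNIV. G w $ v)"
    have "P \<noteq> 0"
    proof
      assume "P = 0"
      then have "G w = 0"
        using nonneg by (simp add: P_def sum_nonneg_eq_0_iff vec_eq_iff)
      then have "w = 0" using right [of w] by (simp add: realization_of_def)
      with w show False by simp
    qed
    then have P: "P > 0"
      using nonneg by (simp add: P_def sum_nonneg order_less_le)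
    have "(\<Sum>v\<in>UNIV. ((1 / P) *\<^sub>R G w) $ v) = 1"
      using P by (simp flip: sum_divide_distrib P_def)
    then have "(1 / P) *\<^sub>R G w \<in> geometric_body K"
      using P nonneg supp by (simp add: mem_geometric_body_iff [OF K])
    moreover have "?h ((1 / P) *\<^sub>R G w) = w"
      using P w by (simp add: realization_of_scaleR right)
    ultimately show "w \<in> ?h ` geometric_body K" by (rule rev_image_eqI [OF _ sym])
  qed
  have "inj_on ?h (geometric_body K)"
  proof (rule inj_onI)
    fix x y assume xy: "x \<in> geometric_body K" "y \<in> geometric_body K" and eq: "?h x = ?h y"
    \<comment> \<open>Injectivity holds on the whole cones, so equal directions give
      \<open>x = u *\<^sub>R y\<close>; both coordinate sums being 1 then forces
      \<open>u = 1\<close>.\<close>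
    define u where "u = norm (?L x) / norm (?L y)"
    have u: "u > 0" using nz xy by (simp add: u_def)
    have "?L x = norm (?L x) *\<^sub>R ?h x" using nz xy by simp
    also have "\<dots> = ?L (u *\<^sub>R y)" unfolding eq by (simp add: u_def realization_of_scaleR)
    finally have "x = u *\<^sub>R y"
      using xy u by (intro inj) (auto simp: mem_geometric_body_iff [OF K])
    moreover have "(\<Sum>v\<in>UNIV. (u *\<^sub>R y) $ v) = u * (\<Sum>v\<in>UNIV. y $ v)"
      by (simp add: sum_distrib_left)
    ultimately show "x = y"
      using xy by (simp add: mem_geometric_body_iff [OF K])
  qed
  then show ?thesis
    using homeomorphic_compact [OF compact cont img] by blast
qed

section \<open>A complete fan for the subdivided bipyramid\<close>

lemma sum_vertex:
  fixes f :: "vertex \<Rightarrow> 'a::comm_monoid_add"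
  shows "(\<Sum>v\<in>UNIV. f v) = f V1 + f V2 + f V3 + f V4 + f V5 + f VT + f VB + f VN"
  by (simp add: UNIV_vertex ac_simps)

lemma all_vertex:
  "(\<forall>v. P v) \<longleftrightarrow> P V1 \<and> P V2 \<and> P V3 \<and> P V4 \<and> P V5 \<and> P VT \<and> P VB \<and> P VN"
  by (metis vertex.exhaust)

lemma abstract_complex_subdivided_bipyramid: "abstract_complex subdivided_bipyramid"
  by (auto simp: abstract_complex_def subdivided_bipyramid_def bipyramid_triangles_def all_vertex)

lemma Collect_mem_subdivided_bipyramid:
  "{v. P v} \<in> subdivided_bipyramid \<longleftrightarrow> (\<exists>\<tau>\<in>bipyramid_triangles. \<forall>v. v \<notin> \<tau> \<longrightarrow> \<not> P v)"
  by (auto simp: subdivided_bipyramid_def)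

text \<open>The octahedral fan with two stellar subdivisions: \<open>V2\<close> is the sum of
  \<open>V1\<close> and \<open>V3\<close>, and \<open>VN\<close> the sum of \<open>VB\<close>,
  \<open>V1\<close> and \<open>V2\<close>. The generators are chosen for the topology alone and are
  unrelated to the points of the flexible polyhedron.\<close>

definition fan_generators :: "(real^3)^vertex" where
  "fan_generators = (\<chi> v. case v of
     V1 \<Rightarrow> vector [1, 0, 0] | V2 \<Rightarrow> vector [1, 1, 0] | V3 \<Rightarrow> vector [0, 1, 0]
   | V4 \<Rightarrow> vector [-1, 0, 0] | V5 \<Rightarrow> vector [0, -1, 0]
   | VT \<Rightarrow> vector [0, 0, 1] | VB \<Rightarrow> vector [0, 0, -1] | VN \<Rightarrow> vector [2, 1, -1])"

lemma realization_of_fan_generators: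
  "realization_of fan_generators x =
     vector [x $ V1 + x $ V2 - x $ V4 + 2 * x $ VN, x $ V2 + x $ V3 - x $ V5 + x $ VN,
             x $ VT - x $ VB - x $ VN]"
  by (simp add: vec_eq_iff forall_3 realization_of_nth sum_vertex fan_generators_def)

text \<open>The coefficient of \<open>VN\<close>, whose generator subdivides the cone over \<open>VB\<close>, \<open>V1\<close>, \<open>V2\<close>.\<close>

definition star_coordinate :: "real^3 \<Rightarrow> real" where
  "star_coordinate w = max 0 (min (- w $ 3) (min (w $ 1 - w $ 2) (w $ 2)))"

text \<open>The coefficients before the second subdivision, with the share of \<open>VN\<close>
  taken equally from \<open>VB\<close>, \<open>V1\<close> and \<open>V2\<close>, whose generators
  add up to that of \<open>VN\<close>.\<close>

definition fan_coordinates :: "real^3 \<Rightarrow> real^vertex" where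
  "fan_coordinates w = (\<chi> v. case v of
       V1 \<Rightarrow> max 0 (w $ 1 - max 0 (w $ 2)) - star_coordinate w
     | V2 \<Rightarrow> max 0 (min (w $ 1) (w $ 2)) - star_coordinate w
     | V3 \<Rightarrow> max 0 (w $ 2 - max 0 (w $ 1))
     | V4 \<Rightarrow> max 0 (- w $ 1)
     | V5 \<Rightarrow> max 0 (- w $ 2)
     | VT \<Rightarrow> max 0 (w $ 3)
     | VB \<Rightarrow> max 0 (- w $ 3) - star_coordinate w
     | VN \<Rightarrow> star_coordinate w)"

text \<open>The first case is the complement of the open cone over \<open>VB\<close>,
  \<open>V1\<close>, \<open>V2\<close>. Inside it the final disjunction tells which of the three
  coefficients drops to 0, hence which of the three triangles at \<open>VN\<close> carries
  \<open>w\<close>.\<close>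

lemma star_coordinate_cases:
  obtains "star_coordinate w = 0" "w $ 3 \<ge> 0 \<or> w $ 1 \<le> w $ 2 \<or> w $ 2 \<le> 0"
  | "star_coordinate w > 0" "star_coordinate w \<le> - w $ 3" "star_coordinate w \<le> w $ 1 - w $ 2"
    "star_coordinate w \<le> w $ 2"
    "star_coordinate w = - w $ 3 \<or> star_coordinate w = w $ 1 - w $ 2 \<or> star_coordinate w = w $ 2"
proof (cases "w $ 3 \<ge> 0 \<or> w $ 1 \<le> w $ 2 \<or> w $ 2 \<le> 0")
  case True
  then have "star_coordinate w = 0"
    by (auto simp: star_coordinate_def max_def min_le_iff_disj)
  with True show thesis by (rule that(1) [rotated])
next
  case False
  then have eq: "star_coordinate w = min (- w $ 3) (min (w $ 1 - w $ 2) (w $ 2))"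
    by (auto simp: star_coordinate_def max_def min_le_iff_disj)
  show thesis
    by (rule that(2)) (use False in \<open>auto simp: eq min_def\<close>)
qed

lemma realization_of_fan_coordinates: "realization_of fan_generators (fan_coordinates w) = w"
  by (cases "0 \<le> w $ 1"; cases "0 \<le> w $ 2"; cases "0 \<le> w $ 3"; cases "w $ 1 \<le> w $ 2")
    (simp_all add: realization_of_fan_generators fan_coordinates_def vec_eq_iff forall_3
      max_def min_def)

lemma fan_coordinates_nonneg: "0 \<le> fan_coordinates w $ v"
  by (cases rule: star_coordinate_cases [of w]; cases v)
    (auto simp: fan_coordinates_def max_def min_def)

lemma fan_coordinates_support: "{v. fan_coordinates w $ v \<noteq> 0} \<in> subdivided_bipyramid"
proof -
  have "\<exists>\<tau>\<in>bipyramid_triangles. \<forall>v. v \<notin> \<tau> \<longrightarrow> fan_coordinates w $ v = 0"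
  proof (cases rule: star_coordinate_cases [of w])
    case 1
    then show ?thesis
      by (cases "0 \<le> w $ 1"; cases "0 \<le> w $ 2"; cases "0 \<le> w $ 3"; cases "w $ 1 \<le> w $ 2")
        (simp_all add: bipyramid_triangles_def all_vertex fan_coordinates_def max_def min_def)
  next
    case 2
    then show ?thesis
      by (elim disjE) (simp_all add: bipyramid_triangles_def all_vertex fan_coordinates_def max_def min_def)
  qed
  then show ?thesis by (simp add: Collect_mem_subdivided_bipyramid)
qed

lemma fan_coordinates_realization_of:
  assumes "\<forall>v. 0 \<le> x $ v" and "{v. x $ v \<noteq> 0} \<in> subdivided_bipyramid"
  shows "fan_coordinates (realization_of fan_generators x) = x"
proof -
  note nonneg = assms(1) [unfolded all_vertex]
  have zeros: "\<exists>\<tau>\<in>bipyramid_triangles. \<forall>v. v \<notin> \<tau> \<longrightarrow> x $ v = 0"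
    using assms by (simp add: Collect_mem_subdivided_bipyramid)
  then have "star_coordinate (realization_of fan_generators x) = x $ VN \<and>
    fan_coordinates (realization_of fan_generators x) = x"
    using nonneg unfolding bipyramid_triangles_def
    by (simp add: all_vertex vec_eq_iff fan_coordinates_def; elim disjE;
        simp add: realization_of_fan_generators star_coordinate_def max_absorb1 min_le_iff_disj)
  then show ?thesis by simp
qed

lemma homeomorphic_sphere_subdivided_bipyramid:
  "geometric_body subdivided_bipyramid homeomorphic sphere (0::real^3) 1"
  by (rule geometric_body_homeomorphic_sphere [OF abstract_complex_subdivided_bipyramid
        fan_coordinates_realization_of realization_of_fan_coordinates fan_coordinates_nonneg
        fan_coordinates_support])

section \<open>Embeddedness by separating planes\<close>

definition separated_by :: "('a::real_inner)^'v::finite \<Rightarrow> 'a \<Rightarrow> real \<Rightarrow> 'v set \<Rightarrow> 'v set \<Rightarrow> bool" where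
  "separated_by p n b \<sigma> \<tau> \<longleftrightarrow>
     (\<forall>v. (v \<in> \<sigma> \<and> v \<in> \<tau> \<longrightarrow> n \<bullet> p $ v = b) \<and>
          (v \<in> \<sigma> \<and> v \<notin> \<tau> \<longrightarrow> b < n \<bullet> p $ v) \<and>
          (v \<notin> \<sigma> \<and> v \<in> \<tau> \<longrightarrow> n \<bullet> p $ v < b))"

definition separated :: "('a::real_inner)^'v::finite \<Rightarrow> 'v set \<Rightarrow> 'v set \<Rightarrow> bool" where
  "separated p \<sigma> \<tau> \<longleftrightarrow> (\<exists>n b. separated_by p n b \<sigma> \<tau>)"

lemma separatedI: "separated_by p n b \<sigma> \<tau> \<Longrightarrow> separated p \<sigma> \<tau>"
  by (auto simp: separated_def)

lemma separated_sym:
  assumes "separated p \<sigma> \<tau>"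
  shows "separated p \<tau> \<sigma>"
proof -
  obtain n b where "separated_by p n b \<sigma> \<tau>" using assms by (auto simp: separated_def)
  then have "separated_by p (- n) (- b) \<tau> \<sigma>" by (auto simp: separated_by_def)
  then show ?thesis by (rule separatedI)
qed

text \<open>Weight the coefficients of \<open>d\<close> by the affine function that vanishes on the
  plane. The sum is 0 because \<open>d\<close> is an affine dependence, and no term is negative, so
  every term vanishes; off the common face the weights are nonzero.\<close>

lemma separated_zero_outside_Int:
  fixes p :: "(real^3)^'v::finite"
  assumes "separated p \<sigma> \<tau>" and "(\<Sum>v\<in>UNIV. d $ v) = 0" and "realization_of p d = 0"
    and pos: "{v. 0 < d $ v} \<subseteq> \<sigma>" and neg: "{v. d $ v < 0} \<subseteq> \<tau>" and v: "v \<notin> \<sigma> \<inter> \<tau>"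
  shows "d $ v = 0"
proof -
  obtain n b where sep: "separated_by p n b \<sigma> \<tau>"
    using assms(1) by (auto simp: separated_def)
  have "(\<Sum>v\<in>UNIV. d $ v * (n \<bullet> p $ v - b)) =
      n \<bullet> realization_of p d - (\<Sum>v\<in>UNIV. d $ v) * b"
    by (simp add: realization_of_def inner_sum_right right_diff_distrib sum_subtractf
        sum_distrib_right)
  then have sum: "(\<Sum>v\<in>UNIV. d $ v * (n \<bullet> p $ v - b)) = 0"
    using assms(2,3) by simp
  have pos: "v \<in> \<sigma>" if "0 < d $ v" for v using pos that by blast
  have neg: "v \<in> \<tau>" if "d $ v < 0" for v using neg that by blast
  have h\<sigma>: "b \<le> n \<bullet> p $ v" if "v \<in> \<sigma>" for v
    using sep that unfolding separated_by_def by (metis order.refl order.strict_implies_order)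
  have h\<tau>: "n \<bullet> p $ v \<le> b" if "v \<in> \<tau>" for v
    using sep that unfolding separated_by_def by (metis order.refl order.strict_implies_order)
  have "0 \<le> d $ v * (n \<bullet> p $ v - b)" for v
  proof (cases "d $ v" "0 :: real" rule: linorder_cases)
    case less
    with h\<tau> [OF neg [OF less]] show ?thesis by (simp add: zero_le_mult_iff)
  next
    case greater
    with h\<sigma> [OF pos [OF greater]] show ?thesis by simp
  qed simp
  then have "d $ v * (n \<bullet> p $ v - b) = 0"
    using sum by (simp add: sum_nonneg_eq_0_iff)
  moreover have "n \<bullet> p $ v \<noteq> b" if "d $ v \<noteq> 0"
  proof -
    have "v \<in> \<sigma> \<or> v \<in> \<tau>" using that pos neg by (meson linorder_neqE)
    then have "b < n \<bullet> p $ v \<or> n \<bullet> p $ v < b"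
      using sep v unfolding separated_by_def by blast
    then show ?thesis by auto
  qed
  ultimately show ?thesis by auto
qed

text \<open>
  Nondegeneracy of a single facet need not be assumed: an affine dependence of its vertices with a
  positive coefficient at \<open>v\<close> is excluded by the plane separating it from the facet opposite \<open>v\<close>.
\<close>

lemma embedded_if_separated:
  fixes p :: "(real^3)^'v::finite"
  assumes K: "abstract_complex K" "K = {\<sigma>. \<exists>\<tau>\<in>F. \<sigma> \<subseteq> \<tau>}"
    and sep: "\<And>\<sigma> \<tau>. \<lbrakk>\<sigma> \<in> F; \<tau> \<in> F; \<sigma> \<noteq> \<tau>\<rbrakk> \<Longrightarrow> separated p \<sigma> \<tau>"
    and adj: "\<And>\<sigma> v. \<lbrakk>\<sigma> \<in> F; v \<in> \<sigma>\<rbrakk> \<Longrightarrow> \<exists>\<tau>\<in>F. v \<notin> \<tau> \<and> \<sigma> - {v} \<subseteq> \<tau>"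
  shows "embedded K (realization_of p)"
proof -
  have single: "d = 0"
    if d: "(\<Sum>v\<in>UNIV. d $ v) = 0" "realization_of p d = 0" and \<sigma>: "\<sigma> \<in> F"
      and supp: "{v. d $ v \<noteq> 0} \<subseteq> \<sigma>" for d \<sigma>
  proof -
    have key: "e $ u = 0"
      if "u \<in> \<sigma>" and e: "(\<Sum>v\<in>UNIV. e $ v) = 0" "realization_of p e = 0"
        and supp: "{v. e $ v \<noteq> 0} \<subseteq> \<sigma>" and u: "0 \<le> e $ u" for e u
    proof -
      obtain \<tau> where \<tau>: "\<tau> \<in> F" "u \<notin> \<tau>" "\<sigma> - {u} \<subseteq> \<tau>"
        using adj [OF \<sigma> \<open>u \<in> \<sigma>\<close>] by blast
      have "{v. e $ v < 0} \<subseteq> \<sigma> - {u}" using supp u by auto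
      then have "{v. 0 < e $ v} \<subseteq> \<sigma>" "{v. e $ v < 0} \<subseteq> \<tau>" using supp \<tau>(3) by auto
      moreover have "\<sigma> \<noteq> \<tau>" using \<tau>(2) \<open>u \<in> \<sigma>\<close> by blast
      ultimately show ?thesis
        using \<tau>(2) by (intro separated_zero_outside_Int [OF sep [OF \<sigma> \<tau>(1)] e]) auto
    qed
    have "d $ u = 0" for u
    proof (cases "u \<in> \<sigma>")
      case True
      have "realization_of p (- d) = 0" using d(2) by (simp add: realization_of_def sum_negf)
      then show ?thesis
        using key [OF True, of d] key [OF True, of "- d"] d supp by (cases "0 \<le> d $ u") (auto simp: sum_negf)
    qed (use supp in auto)
    then show "d = 0" by (simp add: vec_eq_iff)
  qed
  show ?thesis
    unfolding embedded_iff [OF K(1)]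
  proof (intro allI impI, elim conjE)
    fix d assume "sign_dependence K d" and d: "realization_of p d = 0"
    then obtain \<sigma> \<tau> where F: "\<sigma> \<in> F" "\<tau> \<in> F" and sum: "(\<Sum>v\<in>UNIV. d $ v) = 0"
      and supp: "{v. 0 < d $ v} \<subseteq> \<sigma>" "{v. d $ v < 0} \<subseteq> \<tau>"
      using K(2) by (auto simp: sign_dependence_def)
    show "d = 0"
    \<comment> \<open>For distinct facets the separating plane confines the support to the common
      face, so everything reduces to dependences within one facet.\<close>
    proof (rule single [OF sum d F(1)], rule subsetI)
      fix v assume "v \<in> {v. d $ v \<noteq> 0}"
      show "v \<in> \<sigma>"
      proof (cases "\<sigma> = \<tau>")
        case True
        then show ?thesis using \<open>v \<in> _\<close> supp by (auto simp: neq_iff)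
      next
        case False
        then show ?thesis
          using separated_zero_outside_Int [OF sep [OF F False] sum d supp, of v] \<open>v \<in> _\<close> by auto
      qed
    qed
  qed
qed

section \<open>A family of bipyramids with prescribed edge lengths\<close>

text \<open>
  Here \<open>\<mu> = 2 / 7\<close>. With the rotation \<open>R\<close> about the third axis with cosine \<open>c\<close> and sine \<open>s\<close>, the points
  \<open>p\<^sub>2\<close> and \<open>p\<^sub>4\<close> lie on the segments from \<open>p\<^sub>3\<close> to \<open>R\<inverse> p\<^sub>3\<close> and to \<open>R p\<^sub>3\<close>, and \<open>p\<^sub>5 = R p\<^sub>1\<close>.
\<close>

definition bipyramid :: "real \<Rightarrow> real \<Rightarrow> real \<Rightarrow> real \<Rightarrow> real \<Rightarrow> real \<Rightarrow> (real^3)^vertex" where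
  "bipyramid a x y z c s =
    (let p1 = vector [x, - y, - z];
         p2 = vector [2 / 7 * x + 5 / 7 * (c * x + s * y), 2 / 7 * y + 5 / 7 * (c * y - s * x), z];
         pB = vector [0, 0, - a]
     in \<chi> v. case v of
       V1 \<Rightarrow> p1
     | V2 \<Rightarrow> p2
     | V3 \<Rightarrow> vector [x, y, z]
     | V4 \<Rightarrow> vector [5 / 7 * x + 2 / 7 * (c * x - s * y), 5 / 7 * y + 2 / 7 * (c * y + s * x), z]
     | V5 \<Rightarrow> vector [c * x + s * y, s * x - c * y, - z]
     | VT \<Rightarrow> vector [0, 0, a]
     | VB \<Rightarrow> pB
     | VN \<Rightarrow> p1 - (9 / 10) *\<^sub>R (p2 - p1) + 3 *\<^sub>R (pB - p1) + (3 / 5) *\<^sub>R cross3 (p2 - p1) (pB - p1))"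

section \<open>Embeddedness of the initial polyhedron\<close>

text \<open>The complex is a closed surface: the witness is the triangle across the edge opposite
  \<open>v\<close>.\<close>

lemma bipyramid_triangles_adjacent:
  assumes "\<sigma> \<in> bipyramid_triangles" and "v \<in> \<sigma>"
  shows "\<exists>\<tau>\<in>bipyramid_triangles. v \<notin> \<tau> \<and> \<sigma> - {v} \<subseteq> \<tau>"
proof -
  have "\<forall>\<sigma>\<in>bipyramid_triangles. \<forall>v. v \<in> \<sigma> \<longrightarrow>
      (\<exists>\<tau>\<in>bipyramid_triangles. v \<notin> \<tau> \<and> (\<forall>w. w \<in> \<sigma> \<longrightarrow> w = v \<or> w \<in> \<tau>))"
    by (simp add: bipyramid_triangles_def all_vertex)
  from this [THEN bspec, OF assms(1), THEN spec, THEN mp, OF assms(2)]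
  obtain \<tau> where "\<tau> \<in> bipyramid_triangles" "v \<notin> \<tau>" "\<forall>w. w \<in> \<sigma> \<longrightarrow> w = v \<or> w \<in> \<tau>"
    by (elim bexE conjE)
  then show ?thesis by (intro bexI [of _ \<tau>]) auto
qed

text \<open>The rotation comes from the rational parametrization of the circle at -5/8, so all
  vertices are rational and the 66 pairs of facets are separated by exact arithmetic.\<close>

lemma embedded_bipyramid:
  "embedded subdivided_bipyramid
     (realization_of (bipyramid 1 (15 / 7) (11 / 4) (5 / 2) (- 39 / 89) (- 80 / 89)))"
proof (rule embedded_if_separated [OF abstract_complex_subdivided_bipyramid subdivided_bipyramid_def])
  let ?p = "bipyramid 1 (15 / 7) (11 / 4) (5 / 2) (- 39 / 89) (- 80 / 89)"
  define p where "p = ?p"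
  have p: "p = (\<chi> v. case v of
      V1 \<Rightarrow> vector [15 / 7, - 11 / 4, - 5 / 2] | V2 \<Rightarrow> vector [- 7955 / 4361, 22691 / 17444, 5 / 2]
    | V3 \<Rightarrow> vector [15 / 7, 11 / 4, 5 / 2] | V4 \<Rightarrow> vector [8585 / 4361, 18659 / 17444, 5 / 2]
    | V5 \<Rightarrow> vector [- 2125 / 623, - 1797 / 2492, - 5 / 2]
    | VT \<Rightarrow> vector [0, 0, 1] | VB \<Rightarrow> vector [0, 0, - 1]
    | VN \<Rightarrow> vector [- 231993 / 43610, - 87569 / 87220, - 117143 / 30527])"
    unfolding p_def bipyramid_def
    by (simp add: Let_def vec_eq_iff all_vertex forall_3 cross3_def)
  have inner_p: "vector [k, l, m] \<bullet> p $ V1 = 15 / 7 * k - 11 / 4 * l - 5 / 2 * m"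
    "vector [k, l, m] \<bullet> p $ V2 = - 7955 / 4361 * k + 22691 / 17444 * l + 5 / 2 * m"
    "vector [k, l, m] \<bullet> p $ V3 = 15 / 7 * k + 11 / 4 * l + 5 / 2 * m"
    "vector [k, l, m] \<bullet> p $ V4 = 8585 / 4361 * k + 18659 / 17444 * l + 5 / 2 * m"
    "vector [k, l, m] \<bullet> p $ V5 = - 2125 / 623 * k - 1797 / 2492 * l - 5 / 2 * m"
    "vector [k, l, m] \<bullet> p $ VT = m"
    "vector [k, l, m] \<bullet> p $ VB = - m"
    "vector [k, l, m] \<bullet> p $ VN = - 231993 / 43610 * k - 87569 / 87220 * l - 117143 / 30527 * m"
    for k l m :: real
    by (simp_all add: p inner_vec_def sum_3)
  let ?T12 = "{VT, V1, V2}"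
  let ?T23 = "{VT, V2, V3}"
  let ?T34 = "{VT, V3, V4}"
  let ?T45 = "{VT, V4, V5}"
  let ?T51 = "{VT, V5, V1}"
  let ?B23 = "{VB, V2, V3}"
  let ?B34 = "{VB, V3, V4}"
  let ?B45 = "{VB, V4, V5}"
  let ?B51 = "{VB, V5, V1}"
  let ?NB1 = "{VN, VB, V1}"
  let ?N12 = "{VN, V1, V2}"
  let ?NB2 = "{VN, VB, V2}"
  \<comment> \<open>The planes were found by a search among normals with small entries; for facets sharing an edge
      the normal is orthogonal to that edge.\<close>
  have sep:
      "separated_by p (vector [-35, -56, 6]) 6 ?T12 ?T23"
      "separated_by p (vector [-1, -1, 0]) 0 ?T12 ?T34"
      "separated_by p (vector [-1, -6, 4]) 4 ?T12 ?T45"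
      "separated_by p (vector [-7, -50, 35]) 35 ?T12 ?T51"
      "separated_by p (vector [0, -2, 1]) (- 443 / 4361) ?T12 ?B23"
      "separated_by p (vector [-1, -2, 1]) 0 ?T12 ?B34"
      "separated_by p (vector [-1, -3, 2]) 1 ?T12 ?B45"
      "separated_by p (vector [0, -1, 1]) (1 / 4) ?T12 ?B51"
      "separated_by p (vector [0, -1, 1]) (1 / 4) ?T12 ?NB1"
      "separated_by p (vector [4361, 0, 3460]) 695 ?T12 ?N12"
      "separated_by p (vector [0, -2, 1]) (- 443 / 4361) ?T12 ?NB2"
      "separated_by p (vector [-14, 6, 9]) 9 ?T23 ?T34"
      "separated_by p (vector [-3, 1, 3]) 3 ?T23 ?T45"
      "separated_by p (vector [0, 0, 1]) 1 ?T23 ?T51"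
      "separated_by p (vector [316, -865, 682]) (95 / 28) ?T23 ?B23"
      "separated_by p (vector [-2, 1, 1]) (27 / 28) ?T23 ?B34"
      "separated_by p (vector [-3, 1, 3]) (8 / 3) ?T23 ?B45"
      "separated_by p (vector [0, 0, 1]) 0 ?T23 ?B51"
      "separated_by p (vector [0, 0, 1]) 0 ?T23 ?NB1"
      "separated_by p (vector [1, 0, 1]) (5895 / 8722) ?T23 ?N12"
      "separated_by p (vector [1, 0, 1]) (5895 / 8722) ?T23 ?NB2"
      "separated_by p (vector [-711, 390, 655]) 655 ?T34 ?T45"
      "separated_by p (vector [0, 0, 1]) 1 ?T34 ?T51"
      "separated_by p (vector [1, -2, 1]) (- 6 / 7) ?T34 ?B23"
      "separated_by p (vector [-916, 95, 687]) (445 / 28) ?T34 ?B34"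
      "separated_by p (vector [-3, 1, 3]) (46469 / 17444) ?T34 ?B45"
      "separated_by p (vector [0, 0, 1]) 0 ?T34 ?B51"
      "separated_by p (vector [0, 0, 1]) 0 ?T34 ?NB1"
      "separated_by p (vector [1, 0, 1]) (3 / 4) ?T34 ?N12"
      "separated_by p (vector [1, 0, 1]) (3 / 4) ?T34 ?NB2"
      "separated_by p (vector [-46, 38, 37]) 37 ?T45 ?T51"
      "separated_by p (vector [0, -3, 1]) (- 3 / 4) ?T45 ?B23"
      "separated_by p (vector [-1, 0, 1]) (4635 / 8722) ?T45 ?B34"
      "separated_by p (vector [-4361, 0, 4692]) 3145 ?T45 ?B45"
      "separated_by p (vector [-1, 0, 2]) (- 990 / 623) ?T45 ?B51"
      "separated_by p (vector [-1, 0, 2]) (- 5 / 3) ?T45 ?NB1"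
      "separated_by p (vector [3, 9, -5]) (- 11 / 2) ?T45 ?N12"
      "separated_by p (vector [0, -3, 1]) (- 3 / 4) ?T45 ?NB2"
      "separated_by p (vector [0, -3, 1]) (- 1 / 2) ?T51 ?B23"
      "separated_by p (vector [-1, -2, 1]) 0 ?T51 ?B34"
      "separated_by p (vector [0, -3, 1]) (- 839 / 2492) ?T51 ?B45"
      "separated_by p (vector [-316, -865, 682]) (- 95 / 28) ?T51 ?B51"
      "separated_by p (vector [-2, -5, 5]) (- 85 / 28) ?T51 ?NB1"
      "separated_by p (vector [4, 11, -6]) (- 187 / 28) ?T51 ?N12"
      "separated_by p (vector [0, -3, 1]) (- 1 / 2) ?T51 ?NB2"
      "separated_by p (vector [-7, 8, -2]) 2 ?B23 ?B34"
      "separated_by p (vector [0, 3, -1]) 1 ?B23 ?B45"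
      "separated_by p (vector [0, 0, 1]) (- 1) ?B23 ?B51"
      "separated_by p (vector [0, 0, 1]) (- 1) ?B23 ?NB1"
      "separated_by p (vector [1, 1, 0]) (- 9129 / 17444) ?B23 ?N12"
      "separated_by p (vector [245, 392, -18]) 18 ?B23 ?NB2"
      "separated_by p (vector [765, 22, -437]) 437 ?B34 ?B45"
      "separated_by p (vector [0, 0, 1]) (- 1) ?B34 ?B51"
      "separated_by p (vector [0, 0, 1]) (- 1) ?B34 ?NB1"
      "separated_by p (vector [1, 1, 0]) (- 1 / 2) ?B34 ?N12"
      "separated_by p (vector [1, 0, 0]) 0 ?B34 ?NB2"
      "separated_by p (vector [-24, 74, 19]) (- 19) ?B45 ?B51"
      "separated_by p (vector [-1, 0, 2]) (- 2) ?B45 ?NB1"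
      "separated_by p (vector [1, 3, -2]) (- 3 / 5) ?B45 ?N12"
      "separated_by p (vector [0, -11, 4]) (- 4) ?B45 ?NB2"
      "separated_by p (vector [-7, -18, 23]) (- 23) ?B51 ?NB1"
      "separated_by p (vector [4, 11, -6]) (- 187 / 28) ?B51 ?N12"
      "separated_by p (vector [1, -5, 0]) 0 ?B51 ?NB2"
      "separated_by p (vector [26299, 67849, -58170]) (60781 / 4) ?NB1 ?N12"
      "separated_by p (vector [87569, -463986, 0]) 0 ?NB1 ?NB2"
      "separated_by p (vector [-5584, -99009, 39088]) (- 52043237 / 2492) ?N12 ?NB2"
    by (simp_all add: separated_by_def all_vertex inner_p)
  note sep = sep [THEN separatedI]
  show "separated ?p \<sigma> \<tau>" if "\<sigma> \<in> bipyramid_triangles" "\<tau> \<in> bipyramid_triangles" "\<sigma> \<noteq> \<tau>" for \<sigma> \<tau>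
    using that unfolding bipyramid_triangles_def p_def [symmetric]
    by (elim insertE emptyE) (simp_all only: sep sep [THEN separated_sym])
  show "\<exists>\<tau>\<in>bipyramid_triangles. v \<notin> \<tau> \<and> \<sigma> - {v} \<subseteq> \<tau>"
    if "\<sigma> \<in> bipyramid_triangles" "v \<in> \<sigma>" for \<sigma> v
    using that by (rule bipyramid_triangles_adjacent)
qed

section \<open>Edge lengths in the family\<close>

text \<open>The cross product is orthogonal to both factors and Lagrange's identity gives its norm,
  so the Gram matrix of the frame determines the norm of every combination.\<close>

lemma norm_frame_combination:
  fixes u v u' v' :: "real^3"
  assumes "u \<bullet> u = u' \<bullet> u'" "v \<bullet> v = v' \<bullet> v'" "u \<bullet> v = u' \<bullet> v'"
  shows "norm (\<alpha> *\<^sub>R u + \<beta> *\<^sub>R v + \<gamma> *\<^sub>R cross3 u v) =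
    norm (\<alpha> *\<^sub>R u' + \<beta> *\<^sub>R v' + \<gamma> *\<^sub>R cross3 u' v')"
proof -
  have "(norm (\<alpha> *\<^sub>R u + \<beta> *\<^sub>R v + \<gamma> *\<^sub>R cross3 u v))\<^sup>2 =
    \<alpha>\<^sup>2 * (u \<bullet> u) + \<beta>\<^sup>2 * (v \<bullet> v) + 2 * \<alpha> * \<beta> * (u \<bullet> v) + \<gamma>\<^sup>2 * ((u \<bullet> u) * (v \<bullet> v) - (u \<bullet> v)\<^sup>2)"
    for u v :: "real^3"
    unfolding power2_norm_eq_inner by (simp add: cross3_def inner_vec_def sum_3) algebra
  then have "(norm (\<alpha> *\<^sub>R u + \<beta> *\<^sub>R v + \<gamma> *\<^sub>R cross3 u v))\<^sup>2 =
    (norm (\<alpha> *\<^sub>R u' + \<beta> *\<^sub>R v' + \<gamma> *\<^sub>R cross3 u' v'))\<^sup>2"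
    by (simp only: assms)
  then show ?thesis by simp
qed

definition frame_point :: "real \<Rightarrow> real \<Rightarrow> real \<Rightarrow> real^3 \<Rightarrow> real^3 \<Rightarrow> real^3 \<Rightarrow> real^3" where
  "frame_point \<alpha> \<beta> \<gamma> A B C = A + \<alpha> *\<^sub>R (B - A) + \<beta> *\<^sub>R (C - A) + \<gamma> *\<^sub>R cross3 (B - A) (C - A)"

text \<open>The side lengths determine the Gram matrix of the frame at \<open>A\<close>. Measuring
  from \<open>B\<close> or \<open>C\<close> instead of \<open>A\<close> only lowers
  \<open>\<alpha>\<close> or \<open>\<beta>\<close> by one.\<close>

lemma dist_frame_point:
  assumes AB: "dist A B = dist A' B'" and AC: "dist A C = dist A' C'" and BC: "dist B C = dist B' C'"
  shows "dist (frame_point \<alpha> \<beta> \<gamma> A B C) A = dist (frame_point \<alpha> \<beta> \<gamma> A' B' C') A'"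
    and "dist (frame_point \<alpha> \<beta> \<gamma> A B C) B = dist (frame_point \<alpha> \<beta> \<gamma> A' B' C') B'"
    and "dist (frame_point \<alpha> \<beta> \<gamma> A B C) C = dist (frame_point \<alpha> \<beta> \<gamma> A' B' C') C'"
proof -
  have u: "(B - A) \<bullet> (B - A) = (B' - A') \<bullet> (B' - A')"
    and v: "(C - A) \<bullet> (C - A) = (C' - A') \<bullet> (C' - A')"
    using AB AC by (simp_all add: dist_norm norm_minus_commute flip: power2_norm_eq_inner)
  have "(norm (B - C))\<^sup>2 = (norm (B' - C'))\<^sup>2"
    using BC by (simp add: dist_norm)
  then have uv: "(B - A) \<bullet> (C - A) = (B' - A') \<bullet> (C' - A')"
    using u v by (simp add: power2_norm_eq_inner inner_diff_left inner_diff_right inner_commute)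
  note frame = norm_frame_combination [OF u v uv]
  have "frame_point \<alpha> \<beta> \<gamma> A B C - A = \<alpha> *\<^sub>R (B - A) + \<beta> *\<^sub>R (C - A) + \<gamma> *\<^sub>R cross3 (B - A) (C - A)" for A B C
    by (simp add: frame_point_def)
  then show "dist (frame_point \<alpha> \<beta> \<gamma> A B C) A = dist (frame_point \<alpha> \<beta> \<gamma> A' B' C') A'"
    by (simp only: dist_norm frame)
  have "frame_point \<alpha> \<beta> \<gamma> A B C - B = (\<alpha> - 1) *\<^sub>R (B - A) + \<beta> *\<^sub>R (C - A) + \<gamma> *\<^sub>R cross3 (B - A) (C - A)" for A B C
    by (simp add: frame_point_def algebra_simps)
  then show "dist (frame_point \<alpha> \<beta> \<gamma> A B C) B = dist (frame_point \<alpha> \<beta> \<gamma> A' B' C') B'"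
    by (simp only: dist_norm frame)
  have "frame_point \<alpha> \<beta> \<gamma> A B C - C = \<alpha> *\<^sub>R (B - A) + (\<beta> - 1) *\<^sub>R (C - A) + \<gamma> *\<^sub>R cross3 (B - A) (C - A)" for A B C
    by (simp add: frame_point_def algebra_simps)
  then show "dist (frame_point \<alpha> \<beta> \<gamma> A B C) C = dist (frame_point \<alpha> \<beta> \<gamma> A' B' C') C'"
    by (simp only: dist_norm frame)
qed

lemma bipyramid_nth:
  fixes a x y z c s
  defines "p \<equiv> bipyramid a x y z c s"
  shows "p $ VT = vector [0, 0, a]" "p $ VB = vector [0, 0, - a]"
    "p $ V1 = vector [x, - y, - z]"
    "p $ V2 = vector [2 / 7 * x + 5 / 7 * (c * x + s * y), 2 / 7 * y + 5 / 7 * (c * y - s * x), z]"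
    "p $ V3 = vector [x, y, z]"
    "p $ V4 = vector [5 / 7 * x + 2 / 7 * (c * x - s * y), 5 / 7 * y + 2 / 7 * (c * y + s * x), z]"
    "p $ V5 = vector [c * x + s * y, s * x - c * y, - z]"
    "p $ VN = frame_point (- 9 / 10) 3 (3 / 5) (p $ V1) (p $ V2) (p $ VB)"
  by (simp_all add: p_def bipyramid_def Let_def frame_point_def)

lemma dist_eq_sqrt:
  fixes p q :: "real^3"
  assumes "(p $ 1 - q $ 1)\<^sup>2 + (p $ 2 - q $ 2)\<^sup>2 + (p $ 3 - q $ 3)\<^sup>2 = r"
  shows "dist p q = sqrt r"
  using assms by (simp add: dist_vec_def L2_set_def sum_3 dist_real_def)

text \<open>The edge lengths depend on four quantities, whereas the family has five degrees of freedom.\<close>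

lemma dist_bipyramid:
  fixes a x y z c s :: real
  assumes cs: "c\<^sup>2 + s\<^sup>2 = 1"
  defines "p \<equiv> bipyramid a x y z c s"
  defines "P \<equiv> x\<^sup>2 + y\<^sup>2 + z\<^sup>2 + a\<^sup>2" and "W \<equiv> a * z" and "D \<equiv> (x\<^sup>2 + y\<^sup>2) * (1 - c)"
    and "E \<equiv> 2 * z\<^sup>2 + x\<^sup>2 + y\<^sup>2 - ((x\<^sup>2 - y\<^sup>2) * (2 / 7 + 5 / 7 * c) + 2 * x * y * (5 / 7 * s))"
  shows "dist (p $ VT) (p $ V1) = sqrt (P + 2 * W)"
    "dist (p $ VT) (p $ V2) = sqrt (P - 2 * W - 20 / 49 * D)"
    "dist (p $ VT) (p $ V3) = sqrt (P - 2 * W)"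
    "dist (p $ VT) (p $ V4) = sqrt (P - 2 * W - 20 / 49 * D)"
    "dist (p $ VT) (p $ V5) = sqrt (P + 2 * W)"
    "dist (p $ V1) (p $ VB) = sqrt (P - 2 * W)"
    "dist (p $ V2) (p $ VB) = sqrt (P + 2 * W - 20 / 49 * D)"
    "dist (p $ VB) (p $ V3) = sqrt (P + 2 * W)"
    "dist (p $ VB) (p $ V4) = sqrt (P + 2 * W - 20 / 49 * D)"
    "dist (p $ VB) (p $ V5) = sqrt (P - 2 * W)"
    "dist (p $ V1) (p $ V2) = sqrt (2 * E - 20 / 49 * D)"
    "dist (p $ V2) (p $ V3) = sqrt (50 / 49 * D)"
    "dist (p $ V3) (p $ V4) = sqrt (8 / 49 * D)"
    "dist (p $ V4) (p $ V5) = sqrt (2 * E - 20 / 49 * D)"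
    "dist (p $ V5) (p $ V1) = sqrt (2 * D)"
  unfolding P_def W_def D_def E_def
  by - (rule dist_eq_sqrt, simp only: p_def bipyramid_nth vector_3,
      (algebra | use cs in algebra | (simp add: power2_eq_square, use cs in algebra)))+

lemma dist_bipyramid_eq:
  assumes "c\<^sup>2 + s\<^sup>2 = 1" and "c'\<^sup>2 + s'\<^sup>2 = 1"
    and "x\<^sup>2 + y\<^sup>2 + z\<^sup>2 + a\<^sup>2 = x'\<^sup>2 + y'\<^sup>2 + z'\<^sup>2 + a'\<^sup>2" and "a * z = a' * z'"
    and "(x\<^sup>2 + y\<^sup>2) * (1 - c) = (x'\<^sup>2 + y'\<^sup>2) * (1 - c')"
    and "2 * z\<^sup>2 + x\<^sup>2 + y\<^sup>2 - ((x\<^sup>2 - y\<^sup>2) * (2 / 7 + 5 / 7 * c) + 2 * x * y * (5 / 7 * s)) =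
      2 * z'\<^sup>2 + x'\<^sup>2 + y'\<^sup>2 - ((x'\<^sup>2 - y'\<^sup>2) * (2 / 7 + 5 / 7 * c') + 2 * x' * y' * (5 / 7 * s'))"
    and "{u, v} \<in> subdivided_bipyramid"
  shows "dist (bipyramid a x y z c s $ u) (bipyramid a x y z c s $ v) =
    dist (bipyramid a' x' y' z' c' s' $ u) (bipyramid a' x' y' z' c' s' $ v)"
proof -
  let ?p = "bipyramid a x y z c s" and ?p' = "bipyramid a' x' y' z' c' s'"
  note eq = dist_bipyramid [OF assms(1), where a = a and x = x and y = y and z = z, unfolded assms(3-6)]
    dist_bipyramid [OF assms(2), where a = a' and x = x' and y = y' and z = z']
  have eqN: "dist (?p $ VN) (?p $ V1) = dist (?p' $ VN) (?p' $ V1)"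
    "dist (?p $ VN) (?p $ V2) = dist (?p' $ VN) (?p' $ V2)"
    "dist (?p $ VN) (?p $ VB) = dist (?p' $ VN) (?p' $ VB)"
    unfolding bipyramid_nth(8) by - (rule dist_frame_point; simp only: eq)+
  have eqN': "dist (?p $ V1) (?p $ VN) = dist (?p' $ V1) (?p' $ VN)"
    "dist (?p $ V2) (?p $ VN) = dist (?p' $ V2) (?p' $ VN)"
    "dist (?p $ VB) (?p $ VN) = dist (?p' $ VB) (?p' $ VN)"
    using eqN by (simp_all only: dist_commute)
  have "\<forall>\<tau>\<in>bipyramid_triangles. \<forall>u\<in>\<tau>. \<forall>v\<in>\<tau>. dist (?p $ u) (?p $ v) = dist (?p' $ u) (?p' $ v)"
    by (simp only: bipyramid_triangles_def ball_simps simp_thms dist_self eq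
        eq [THEN dist_commute [THEN trans]] eqN eqN')
  moreover obtain \<tau> where "\<tau> \<in> bipyramid_triangles" "u \<in> \<tau>" "v \<in> \<tau>"
    using assms(7) by (auto simp: subdivided_bipyramid_def)
  ultimately show ?thesis by blast
qed

section \<open>The flex\<close>

lemma isCont_bipyramid:
  assumes "isCont a t" "isCont x t" "isCont y t" "isCont z t" "isCont c t" "isCont s t"
  shows "isCont (\<lambda>t. bipyramid (a t) (x t) (y t) (z t) (c t) (s t)) t"
proof -
  have "isCont (\<lambda>t. bipyramid (a t) (x t) (y t) (z t) (c t) (s t) $ v $ i) t" for v i
  proof -
    have "\<forall>v. \<forall>i. isCont (\<lambda>t. bipyramid (a t) (x t) (y t) (z t) (c t) (s t) $ v $ i) t"
      using assms by (simp add: all_vertex forall_3 bipyramid_nth frame_point_def cross3_def)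
    then show ?thesis by blast
  qed
  then show ?thesis
    unfolding isCont_def by (intro vec_tendstoI)
qed

lemma eventually_pos_nhds:
  fixes f :: "real \<Rightarrow> real"
  assumes "\<forall>\<^sub>F a in nhds a0. isCont f a" and "0 < f a0"
  shows "\<forall>\<^sub>F a in nhds a0. 0 < f a"
proof -
  have "(f \<longlongrightarrow> f a0) (nhds a0)"
    using eventually_nhds_x_imp_x [OF assms(1)] by (simp add: isCont_def tendsto_at_iff_tendsto_nhds)
  then show ?thesis using assms(2) by (rule order_tendstoD)
qed

text \<open>\<open>E\<close> and \<open>Q\<close> are the components of \<open>(X, Y)\<close> along
  \<open>(g, h)\<close> and along its perpendicular \<open>(h, -g)\<close>, scaled by the length of
  \<open>(g, h)\<close>. The second equation is the two-squares identity.\<close>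

lemma rotated_components:
  fixes E Q g h :: real
  assumes "0 < g\<^sup>2 + h\<^sup>2"
  defines "X \<equiv> (E * g + Q * h) / (g\<^sup>2 + h\<^sup>2)" and "Y \<equiv> (E * h - Q * g) / (g\<^sup>2 + h\<^sup>2)"
  shows "X * g + Y * h = E" and "X\<^sup>2 + Y\<^sup>2 = (E\<^sup>2 + Q\<^sup>2) / (g\<^sup>2 + h\<^sup>2)"
proof -
  have "X * g + Y * h = E * (g\<^sup>2 + h\<^sup>2) / (g\<^sup>2 + h\<^sup>2)"
    by (simp add: X_def Y_def add_divide_distrib diff_divide_distrib power2_eq_square algebra_simps)
  then show "X * g + Y * h = E" using assms(1) by auto
  have "X\<^sup>2 + Y\<^sup>2 = ((E * g + Q * h)\<^sup>2 + (E * h - Q * g)\<^sup>2) / (g\<^sup>2 + h\<^sup>2)\<^sup>2"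
    unfolding X_def Y_def power_divide by (rule add_divide_distrib [symmetric])
  also have "(E * g + Q * h)\<^sup>2 + (E * h - Q * g)\<^sup>2 = (E\<^sup>2 + Q\<^sup>2) * (g\<^sup>2 + h\<^sup>2)"
    by algebra
  finally show "X\<^sup>2 + Y\<^sup>2 = (E\<^sup>2 + Q\<^sup>2) / (g\<^sup>2 + h\<^sup>2)"
    using assms(1) by (simp add: power2_eq_square)
qed

text \<open>
  With \<open>a\<close> as parameter, the first three of the four quantities determine \<open>z\<close>, \<open>r = x\<^sup>2 + y\<^sup>2\<close> and \<open>c\<close>. The last
  one is a linear equation for \<open>X = x\<^sup>2 - y\<^sup>2\<close> and \<open>Y = 2 x y\<close>, to be solved on the circle \<open>X\<^sup>2 + Y\<^sup>2 = r\<^sup>2\<close>.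
\<close>

lemma flex_parameters:
  obtains x y z c s :: "real \<Rightarrow> real" where
    "x 1 = 15 / 7" "y 1 = 11 / 4" "z 1 = 5 / 2" "c 1 = - 39 / 89" "s 1 = - 80 / 89"
    "\<forall>\<^sub>F a in nhds 1. isCont x a \<and> isCont y a \<and> isCont z a \<and> isCont c a \<and> isCont s a \<and>
      (c a)\<^sup>2 + (s a)\<^sup>2 = 1 \<and>
      (x a)\<^sup>2 + (y a)\<^sup>2 + (z a)\<^sup>2 + a\<^sup>2 = 15213 / 784 \<and>
      a * z a = 5 / 2 \<and>
      ((x a)\<^sup>2 + (y a)\<^sup>2) * (1 - c a) = 76232 / 4361 \<and>
      2 * (z a)\<^sup>2 + (x a)\<^sup>2 + (y a)\<^sup>2 -
        (((x a)\<^sup>2 - (y a)\<^sup>2) * (2 / 7 + 5 / 7 * c a) + 2 * x a * y a * (5 / 7 * s a)) =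
        7849187 / 244216"
proof -
  \<comment> \<open>The constants are the values of the four quantities at the initial
    parameters.\<close>
  define z :: "real \<Rightarrow> real" where "z = (\<lambda>a. 5 / (2 * a))"
  define r where "r = (\<lambda>a. 15213 / 784 - (z a)\<^sup>2 - a\<^sup>2)"
  define c where "c = (\<lambda>a. 1 - 76232 / 4361 / r a)"
  \<comment> \<open>The signs of this root, of \<open>Q\<close> and of \<open>x\<close> select the
    branch through the initial position.\<close>
  define s where "s = (\<lambda>a. - sqrt (1 - (c a)\<^sup>2))"
  define g where "g = (\<lambda>a. 2 / 7 + 5 / 7 * c a)"
  define h where "h = (\<lambda>a. 5 / 7 * s a)"
  define G where "G = (\<lambda>a. (g a)\<^sup>2 + (h a)\<^sup>2)"
  define E where "E = (\<lambda>a. 2 * (z a)\<^sup>2 + r a - 7849187 / 244216)"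
  define Q where "Q = (\<lambda>a. sqrt ((r a)\<^sup>2 * G a - (E a)\<^sup>2))"
  define X where "X = (\<lambda>a. (E a * g a + Q a * h a) / G a)"
  define Y where "Y = (\<lambda>a. (E a * h a - Q a * g a) / G a)"
  define x where "x = (\<lambda>a. sqrt ((r a + X a) / 2))"
  \<comment> \<open>Division makes \<open>2 * x a * y a = Y a\<close> hold without another choice of
    sign.\<close>
  define y where "y = (\<lambda>a. Y a / (2 * x a))"
  have z1: "z 1 = 5 / 2" by (simp add: z_def)
  have r1: "r 1 = 9529 / 784" by (simp add: r_def z1 power2_eq_square)
  have c1: "c 1 = - 39 / 89" by (simp add: c_def r1)
  have s1: "s 1 = - 80 / 89"
  proof -
    have "sqrt (1 - (- 39 / 89)\<^sup>2) = 80 / 89"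
      by (rule real_sqrt_unique) (simp_all add: power2_eq_square)
    then show ?thesis by (simp add: s_def c1)
  qed
  have g1: "g 1 = - 17 / 623" by (simp add: g_def c1)
  have h1: "h 1 = - 400 / 623" by (simp add: h_def s1)
  have G1: "G 1 = 1801 / 4361" by (simp add: G_def g1 h1 power2_eq_square)
  have E1: "E 1 = - 3656407 / 488432" by (simp add: E_def z1 r1 power2_eq_square)
  have Q1: "Q 1 = 136085 / 61054"
    unfolding Q_def r1 G1 E1 by (rule real_sqrt_unique) (simp_all add: power2_eq_square)
  have X1: "X 1 = - 2329 / 784" by (simp add: X_def E1 g1 Q1 h1 G1)
  have Y1: "Y 1 = 165 / 14" by (simp add: Y_def E1 g1 Q1 h1 G1)
  have x1: "x 1 = 15 / 7"
    unfolding x_def r1 X1 by (rule real_sqrt_unique) (simp_all add: power2_eq_square)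
  have y1: "y 1 = 11 / 4" by (simp add: y_def Y1 x1)
  \<comment> \<open>Radicands and denominators are positive at 1, hence nearby: quotients stay
    continuous and roots square back.\<close>
  have pos: "\<forall>\<^sub>F a::real in nhds 1. 0 < a"
    by (rule eventually_pos_nhds) simp_all
  then have z: "\<forall>\<^sub>F a in nhds 1. isCont z a"
    unfolding z_def by eventually_elim simp
  then have r: "\<forall>\<^sub>F a in nhds 1. isCont r a"
    unfolding r_def by eventually_elim simp
  have r_pos: "\<forall>\<^sub>F a in nhds 1. 0 < r a"
    using r by (rule eventually_pos_nhds) (simp add: r1)
  have c: "\<forall>\<^sub>F a in nhds 1. isCont c a"
    using r r_pos unfolding c_def by eventually_elim simp
  have c2: "\<forall>\<^sub>F a in nhds 1. isCont (\<lambda>a. 1 - (c a)\<^sup>2) a"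
    using c by eventually_elim simp
  have c2_pos: "\<forall>\<^sub>F a in nhds 1. 0 < 1 - (c a)\<^sup>2"
    using c2 by (rule eventually_pos_nhds) (simp add: c1 power2_eq_square)
  have s: "\<forall>\<^sub>F a in nhds 1. isCont s a"
    unfolding s_def using c by eventually_elim (simp add: continuous_real_sqrt)
  have g: "\<forall>\<^sub>F a in nhds 1. isCont g a" and h: "\<forall>\<^sub>F a in nhds 1. isCont h a"
    unfolding g_def h_def using c s by (eventually_elim, simp)+
  have G: "\<forall>\<^sub>F a in nhds 1. isCont G a"
    unfolding G_def using g h by eventually_elim simp
  have G_pos: "\<forall>\<^sub>F a in nhds 1. 0 < G a"
    using G by (rule eventually_pos_nhds) (simp add: G1)
  have E: "\<forall>\<^sub>F a in nhds 1. isCont E a"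
    unfolding E_def using z r by eventually_elim simp
  have Q2: "\<forall>\<^sub>F a in nhds 1. isCont (\<lambda>a. (r a)\<^sup>2 * G a - (E a)\<^sup>2) a"
    using r G E by eventually_elim simp
  have Q2_pos: "\<forall>\<^sub>F a in nhds 1. 0 < (r a)\<^sup>2 * G a - (E a)\<^sup>2"
    using Q2 by (rule eventually_pos_nhds) (simp add: r1 G1 E1 power2_eq_square)
  have Q: "\<forall>\<^sub>F a in nhds 1. isCont Q a"
    unfolding Q_def using Q2 by eventually_elim (rule continuous_real_sqrt)
  have X: "\<forall>\<^sub>F a in nhds 1. isCont X a" and Y: "\<forall>\<^sub>F a in nhds 1. isCont Y a"
    unfolding X_def Y_def using G_pos E g Q h G by (eventually_elim, simp)+
  have rX: "\<forall>\<^sub>F a in nhds 1. isCont (\<lambda>a. r a + X a) a"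
    using r X by eventually_elim simp
  have rX_pos: "\<forall>\<^sub>F a in nhds 1. 0 < r a + X a"
    using rX by (rule eventually_pos_nhds) (simp add: r1 X1)
  have x: "\<forall>\<^sub>F a in nhds 1. isCont x a"
    unfolding x_def using r X by eventually_elim (simp add: continuous_real_sqrt)
  have y: "\<forall>\<^sub>F a in nhds 1. isCont y a"
    unfolding y_def using x Y rX_pos by eventually_elim (auto simp: x_def)
  show thesis
  proof (rule that [of x y z c s, OF x1 y1 z1 c1 s1])
    show "\<forall>\<^sub>F a in nhds 1. isCont x a \<and> isCont y a \<and> isCont z a \<and> isCont c a \<and> isCont s a \<and>
      (c a)\<^sup>2 + (s a)\<^sup>2 = 1 \<and>
      (x a)\<^sup>2 + (y a)\<^sup>2 + (z a)\<^sup>2 + a\<^sup>2 = 15213 / 784 \<and>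
      a * z a = 5 / 2 \<and>
      ((x a)\<^sup>2 + (y a)\<^sup>2) * (1 - c a) = 76232 / 4361 \<and>
      2 * (z a)\<^sup>2 + (x a)\<^sup>2 + (y a)\<^sup>2 -
        (((x a)\<^sup>2 - (y a)\<^sup>2) * (2 / 7 + 5 / 7 * c a) + 2 * x a * y a * (5 / 7 * s a)) =
        7849187 / 244216"
      using pos r_pos c2_pos G_pos Q2_pos
        rX_pos x y z c s
    proof eventually_elim
      case (elim a)
      have s2: "(s a)\<^sup>2 = 1 - (c a)\<^sup>2" using elim by (simp add: s_def)
      have "0 < (g a)\<^sup>2 + (h a)\<^sup>2" using elim by (simp add: G_def)
      from rotated_components [OF this, of "E a" "Q a"]
      have XY: "X a * g a + Y a * h a = E a" "(X a)\<^sup>2 + (Y a)\<^sup>2 = ((E a)\<^sup>2 + (Q a)\<^sup>2) / G a"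
        by (simp_all add: X_def Y_def G_def)
      have "(Q a)\<^sup>2 = (r a)\<^sup>2 * G a - (E a)\<^sup>2" using elim by (simp add: Q_def)
      then have X2Y2: "(X a)\<^sup>2 + (Y a)\<^sup>2 = (r a)\<^sup>2" using XY(2) elim by simp
      have x2: "(x a)\<^sup>2 = (r a + X a) / 2" "x a > 0" using elim by (simp_all add: x_def)
      have "2 * x a * y a = Y a" using x2 by (simp add: y_def)
      then have "4 * (x a)\<^sup>2 * (y a)\<^sup>2 = (Y a)\<^sup>2"
        by (simp add: power_mult_distrib flip: \<open>2 * x a * y a = Y a\<close>)
      also have "\<dots> = (r a)\<^sup>2 - (X a)\<^sup>2" using X2Y2 by simp
      also have "\<dots> = 2 * (r a + X a) * ((r a - X a) / 2)"
        by (simp add: power2_eq_square field_simps)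
      also have "2 * (r a + X a) = 4 * (x a)\<^sup>2" by (simp add: x2)
      finally have y2: "(y a)\<^sup>2 = (r a - X a) / 2" using x2(2) by simp
      have S: "(x a)\<^sup>2 + (y a)\<^sup>2 = r a" "(x a)\<^sup>2 - (y a)\<^sup>2 = X a" by (simp_all add: x2 y2 field_simps)
      have "(x a)\<^sup>2 + (y a)\<^sup>2 + (z a)\<^sup>2 + a\<^sup>2 = 15213 / 784"
        using S(1) by (simp add: r_def)
      moreover have "a * z a = 5 / 2" using elim by (simp add: z_def)
      moreover have "((x a)\<^sup>2 + (y a)\<^sup>2) * (1 - c a) = 76232 / 4361"
        using elim by (simp add: S(1) c_def)
      moreover have "2 * (z a)\<^sup>2 + (x a)\<^sup>2 + (y a)\<^sup>2 -
          (((x a)\<^sup>2 - (y a)\<^sup>2) * (2 / 7 + 5 / 7 * c a) + 2 * x a * y a * (5 / 7 * s a)) =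
          7849187 / 244216"
        unfolding S(2) \<open>2 * x a * y a = Y a\<close>
        using XY(1) S(1) by (simp add: g_def h_def E_def)
      ultimately show ?case using elim s2 by simp
    qed
  qed
qed

section \<open>Assembly of the flex\<close>

lemma dist_direct_isometry:
  assumes "direct_isometry g"
  shows "dist (g x) (g y) = dist x y"
proof -
  obtain A b where A: "rotation_matrix A" "g = (\<lambda>x. A *v x + b)"
    using assms by (auto simp: direct_isometry_def)
  then have "orthogonal_transformation ((*v) A)"
    by (simp add: rotation_matrix_def orthogonal_transformation_matrix)
  then have "norm (A *v (x - y)) = norm (x - y)"
    by (rule orthogonal_transformation_norm)
  then show ?thesis
    by (simp add: A(2) dist_norm matrix_vector_mult_diff_distrib)
qed

lemma dist_bipyramid_apexes:
  "dist (bipyramid a x y z c s $ VT) (bipyramid a x y z c s $ VB) = 2 * \<bar>a\<bar>"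
proof -
  have "dist (bipyramid a x y z c s $ VT) (bipyramid a x y z c s $ VB) = sqrt ((2 * a)\<^sup>2)"
    by (rule dist_eq_sqrt) (simp add: bipyramid_nth)
  then show ?thesis by (simp only: real_sqrt_abs abs_mult abs_numeral)
qed

lemma bipyramid_flex:
  defines "p \<equiv> bipyramid 1 (15 / 7) (11 / 4) (5 / 2) (- 39 / 89) (- 80 / 89)"
  shows "\<exists>f. flex subdivided_bipyramid (realization_of p) f \<and>
    no_self_intersections subdivided_bipyramid f"
proof -
  obtain x y z c s :: "real \<Rightarrow> real" where
    init: "x 1 = 15 / 7" "y 1 = 11 / 4" "z 1 = 5 / 2" "c 1 = - 39 / 89" "s 1 = - 80 / 89" and
    ev: "\<forall>\<^sub>F a in nhds 1. isCont x a \<and> isCont y a \<and> isCont z a \<and> isCont c a \<and> isCont s a \<and>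
      (c a)\<^sup>2 + (s a)\<^sup>2 = 1 \<and>
      (x a)\<^sup>2 + (y a)\<^sup>2 + (z a)\<^sup>2 + a\<^sup>2 = 15213 / 784 \<and>
      a * z a = 5 / 2 \<and>
      ((x a)\<^sup>2 + (y a)\<^sup>2) * (1 - c a) = 76232 / 4361 \<and>
      2 * (z a)\<^sup>2 + (x a)\<^sup>2 + (y a)\<^sup>2 -
        (((x a)\<^sup>2 - (y a)\<^sup>2) * (2 / 7 + 5 / 7 * c a) + 2 * x a * y a * (5 / 7 * s a)) =
        7849187 / 244216"
    by (rule flex_parameters)
  define F where "F = (\<lambda>a. bipyramid a (x a) (y a) (z a) (c a) (s a))"
  have F1: "F 1 = p" by (simp add: F_def init p_def)
  have cont: "\<forall>\<^sub>F a in nhds 1. isCont F a"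
    using ev unfolding F_def by eventually_elim (intro isCont_bipyramid; simp)
  have lengths: "\<forall>\<^sub>F a in nhds 1. \<forall>u v. {u, v} \<in> subdivided_bipyramid \<longrightarrow>
      dist (F a $ u) (F a $ v) = dist (p $ u) (p $ v)"
    using ev
  proof eventually_elim
    case (elim a)
    \<comment> \<open>The initial polyhedron is the member at parameter 1 and satisfies the same
      four equations, so both configurations share the four quantities.\<close>
    note at_1 = eventually_nhds_x_imp_x [OF ev]
    show ?case
      unfolding F1 [symmetric] F_def
      by (intro allI impI dist_bipyramid_eq) (use elim at_1 in \<open>simp_all only:\<close>)
  qed
  have "(F \<longlongrightarrow> F 1) (nhds 1)"
    using eventually_nhds_x_imp_x [OF cont] by (simp add: isCont_def tendsto_at_iff_tendsto_nhds)
  then have "\<forall>\<^sub>F a in nhds 1. F a \<in> {p. embedded subdivided_bipyramid (realization_of p)}"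
    by (rule topological_tendstoD [OF _ open_embedded [OF abstract_complex_subdivided_bipyramid]])
      (use embedded_bipyramid in \<open>simp only: F1 p_def mem_Collect_eq\<close>)
  with cont lengths have "\<forall>\<^sub>F a in nhds 1. isCont F a \<and>
      (\<forall>u v. {u, v} \<in> subdivided_bipyramid \<longrightarrow> dist (F a $ u) (F a $ v) = dist (p $ u) (p $ v)) \<and>
      embedded subdivided_bipyramid (realization_of (F a))"
    by eventually_elim simp
  then obtain d where "0 < d" and d: "\<And>a. dist a 1 < d \<Longrightarrow> isCont F a \<and>
      (\<forall>u v. {u, v} \<in> subdivided_bipyramid \<longrightarrow> dist (F a $ u) (F a $ v) = dist (p $ u) (p $ v)) \<and>
      embedded subdivided_bipyramid (realization_of (F a))"
    by (auto simp: eventually_nhds_metric)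
  \<comment> \<open>The parameter moves from 1 to one side only, by less than
    \<open>d / 2\<close>.\<close>
  define f where "f = (\<lambda>t. F (1 + d / 2 * t))"
  have near: "dist (1 + d / 2 * t) 1 < d" if "t \<in> {0..<1}" for t
  proof -
    have "d * t < d * 1" using that \<open>0 < d\<close> by (intro mult_strict_left_mono) auto
    then show ?thesis using that \<open>0 < d\<close> by (simp add: dist_real_def)
  qed
  have "continuous_on {0..<1} f"
    unfolding f_def
  proof (rule continuous_at_imp_continuous_on, rule ballI)
    fix t :: real assume "t \<in> {0..<1}"
    then have "isCont F (1 + d / 2 * t)" using d near by blast
    then show "isCont (\<lambda>t. F (1 + d / 2 * t)) t"
      by (rule isCont_o2 [where f = "\<lambda>t. 1 + d / 2 * t", rotated]) simp
  qed
  moreover have "f 0 $ v = realization_of p (vertex_point v)" for v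
    by (simp add: f_def F1 realization_of_vertex_point)
  moreover have "dist (f t $ u) (f t $ v) =
      dist (realization_of p (vertex_point u)) (realization_of p (vertex_point v))"
    if "t \<in> {0..<1}" "{u, v} \<in> subdivided_bipyramid" for t u v
    using d [OF near] that by (simp add: f_def realization_of_vertex_point)
  moreover have emb: "embedded subdivided_bipyramid (realization_of (f t))"
    if "t \<in> {0..<1}" for t
    using d [OF near] that by (simp add: f_def)
  \<comment> \<open>Vertices are points of the body, so embeddedness already keeps their images
    distinct.\<close>
  moreover have "f t $ u \<noteq> f t $ v" if "t \<in> {0..<1}" "u \<noteq> v" for t u v
  proof -
    have "vertex_point w \<in> geometric_body subdivided_bipyramid" for w
      using abstract_complex_subdivided_bipyramid
      by (auto simp: geometric_body_def face_def abstract_complex_def intro!: bexI [of _ "{w}"])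
    then show ?thesis
      using inj_onD [OF emb [OF that(1), unfolded embedded_def], of "vertex_point u" "vertex_point v"] that(2)
      by (auto simp: realization_of_vertex_point axis_eq_axis)
  qed
  moreover have "\<not> (\<exists>g. direct_isometry g \<and> (\<forall>v. f t2 $ v = g (f t1 $ v)))"
    if "t1 \<in> {0..<1}" "t2 \<in> {0..<1}" "t1 \<noteq> t2" for t1 t2
  proof
    assume "\<exists>g. direct_isometry g \<and> (\<forall>v. f t2 $ v = g (f t1 $ v))"
    then have "dist (f t2 $ VT) (f t2 $ VB) = dist (f t1 $ VT) (f t1 $ VB)"
      by (auto simp: dist_direct_isometry)
    \<comment> \<open>The parameters are positive, so the absolute value in the apex distance loses
      nothing and the distance determines the time.\<close>
    moreover have "0 \<le> d / 2 * t1" "0 \<le> d / 2 * t2" using that \<open>0 < d\<close> by simp_all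
    ultimately show False
      using that \<open>0 < d\<close> by (simp add: f_def F_def dist_bipyramid_apexes)
  qed
  ultimately have "flex subdivided_bipyramid (realization_of p) f" 
    by (simp add: flex_def)
  moreover have "no_self_intersections subdivided_bipyramid f"
    using emb by (simp add: no_self_intersections_def)
  ultimately show ?thesis by blast
qed

theorem theorem4p6:
  fixes t a x\<^sub>3 y\<^sub>3 z\<^sub>3 \<mu> c s :: real
    and p :: "(real^3)^vertex"
  assumes "t = - 5 / 8" and "a = 1" and "x\<^sub>3 = 15 / 7" and "y\<^sub>3 = 11 / 4" and "z\<^sub>3 = 5 / 2"
    and "\<mu> = 2 / 7"
    and "c = (t\<^sup>2 - 1) / (t\<^sup>2 + 1)" and "s = 2 * t / (t\<^sup>2 + 1)"
    and "p $ VT = vector [0, 0, a]"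
    and "p $ VB = vector [0, 0, - a]"
    and "p $ V3 = vector [x\<^sub>3, y\<^sub>3, z\<^sub>3]"
    and "p $ V1 = vector [x\<^sub>3, - y\<^sub>3, - z\<^sub>3]"
    and "p $ V5 = vector [c * x\<^sub>3 + s * y\<^sub>3, - c * y\<^sub>3 + s * x\<^sub>3, - z\<^sub>3]"
    and "p $ V2 = vector [- (\<mu> * (c - 1) - c) * x\<^sub>3 - (\<mu> * s - s) * y\<^sub>3,
                          (\<mu> * s - s) * x\<^sub>3 - (\<mu> * (c - 1) - c) * y\<^sub>3,
                          z\<^sub>3]"
    and "p $ V4 = vector [- \<mu> * s * y\<^sub>3 + (\<mu> * (c - 1) + 1) * x\<^sub>3,
                          \<mu> * s * x\<^sub>3 + (\<mu> * (c - 1) + 1) * y\<^sub>3,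
                          z\<^sub>3]"
    and "p $ VN = p $ V1 - (9 / 10) *\<^sub>R (p $ V2 - p $ V1) + 3 *\<^sub>R (p $ VB - p $ V1)
                    + (3 / 5) *\<^sub>R cross3 (p $ V2 - p $ V1) (p $ VB - p $ V1)"
  shows "(\<exists>f. flex subdivided_bipyramid (realization_of p) f \<and>
              no_self_intersections subdivided_bipyramid f) \<and>
         flexible_embedded_polyhedron subdivided_bipyramid (realization_of p) \<and>
         card {v. {v} \<in> subdivided_bipyramid} = 8"
proof -
  have cs: "c = - 39 / 89" "s = - 80 / 89"
    unfolding assms(1,7,8) by (simp_all add: power2_eq_square)
  \<comment> \<open>The coefficient \<open>- (\<mu> * (c - 1) - c)\<close> is
    \<open>\<mu> + (1 - \<mu>) * c\<close>: the given formulas for \<open>V2\<close> and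
    \<open>V4\<close> are the convex combinations used in \<open>bipyramid\<close>.\<close>
  have p: "p = bipyramid 1 (15 / 7) (11 / 4) (5 / 2) (- 39 / 89) (- 80 / 89)"
    unfolding vec_eq_iff [of p] all_vertex bipyramid_nth assms(9-16) cs assms(2-6)
    by (simp add: frame_point_def)
  have sphere: "spherical_polyhedron subdivided_bipyramid (realization_of p)"
    by (simp add: spherical_polyhedron_def abstract_complex_subdivided_bipyramid
        realization_realization_of homeomorphic_sphere_subdivided_bipyramid)
  have "{v. {v} \<in> subdivided_bipyramid} = UNIV"
    using abstract_complex_subdivided_bipyramid by (simp add: abstract_complex_def)
  then have "card {v. {v} \<in> subdivided_bipyramid} = 8"
    by (simp add: UNIV_vertex)
  then show ?thesis
    using bipyramid_flex embedded_bipyramid sphere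
    unfolding flexible_embedded_polyhedron_def p by blast
qed

end
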